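(* Let $n \geq 1$, let $(\ell_d)_{d \in D_n}$ be integers with $\ell_d \geq 2$ for all $d \in D_n$, and let $\lambda_{[n]}$ be the number defined from $(\ell_d)_{d\in D_n}$ as in the context. Let $S \subset \mathbb{R}^n$ have size $$|S| > \lambda_{[n]}.$$ Then $S$ contains a strictly monotonic sequence of length $\ell_d + 1$ in direction $d$ for some $d \in D_n$. In particular, for a positive integer $\ell$, if $|S| > \ell^{2^n-1}$ then $S$ contains a strictly monotonic sequence of length $\ell+1$ (in some direction).
   Context: Notation: $[n] = \{1,\ldots,n\}$. A sequence of points $(x^j)_{j=1}^{\ell}$ with $x^j \in \mathbb{R}^n$ is strictly monotonic in direction $d \in \{-1,0,1\}^n$ if for each $i \in [n]$ the $i$th coordinate sequence $(x^j_i)_{j=1}^{\ell}$ is strictly decreasing, constant, or strictly increasing according to whether $d_i = -1$, $0$ or $1$ respectively. It is strictly monotonic if it is strictly monotonic in some direction. A set $S \subset \mathbb{R}^n$ contains a strictly monotonic sequence of length $\ell$ (in direction $d$) if there are distinct points $\{x^1,\ldots,x^\ell\} \subset S$ such that the sequence $(x^j)_{j=1}^{\ell}$ is strictly monotonic (in direction $d$). $D_n = \{ d \in \{-1,0,1\}^n : d \neq (0,\ldots,0),\ d_{i_0} = 1 \text{ where } i_0 = \min\{i : d_i \neq 0\}\}$. For $d \in \{-1,0,1\}^n$ let $N(d) = \{ i \in [n] : d_i \neq 0\}$. Given $(\ell_d)_{d \in D_n}$, for nonempty $I \subset [n]$ put $m_I = \prod_{d \in D_n : N(d) = I} \ell_d$,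 and define $\lambda_I$ for $I \subset [n]$ recursively by $\lambda_\emptyset = 1$ and $\lambda_I = m_I \cdot \max_{i \in I} \lambda_{I \setminus \{i\}}$ for $I \neq \emptyset$. *)

theory Defs
  imports "HOL-Analysis.Analysis"
begin

(* The index set [n] is modelled by a finite linearly ordered type 'n with CARD('n) = n;
   the order matters only for the smallest nonzero coordinate in the definition of D_n. *)

definition sign_vectors :: "(int ^ 'n) set" where
  "sign_vectors = {d. \<forall>i. d $ i \<in> {-1, 0, 1}}"

definition supp :: "int ^ 'n \<Rightarrow> 'n set" where
  "supp d = {i. d $ i \<noteq> 0}"

definition D_n :: "(int ^ 'n::{finite,linorder}) set" where
  "D_n = {d \<in> sign_vectors. d \<noteq> 0 \<and> d $ Min (supp d) = 1}"

(* A sequence x^1, ..., x^L is a function on nat of which only the values on {1..L} matter. *)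

definition strictly_monotonic_dir ::
    "(nat \<Rightarrow> real ^ 'n) \<Rightarrow> nat \<Rightarrow> int ^ 'n \<Rightarrow> bool" where
  "strictly_monotonic_dir x L d \<longleftrightarrow>
     (\<forall>i. (d $ i = -1 \<longrightarrow> strict_antimono_on {1..L} (\<lambda>j. x j $ i)) \<and>
          (d $ i = 0 \<longrightarrow> (\<lambda>j. x j $ i) constant_on {1..L}) \<and>
          (d $ i = 1 \<longrightarrow> strict_mono_on {1..L} (\<lambda>j. x j $ i)))"

definition strictly_monotonic :: "(nat \<Rightarrow> real ^ 'n) \<Rightarrow> nat \<Rightarrow> bool" where
  "strictly_monotonic x L \<longleftrightarrow> (\<exists>d\<in>sign_vectors. strictly_monotonic_dir x L d)"

definition contains_monotonic_dir ::
    "(real ^ 'n) set \<Rightarrow> nat \<Rightarrow> int ^ 'n \<Rightarrow> bool" where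
  "contains_monotonic_dir S L d \<longleftrightarrow>
     (\<exists>x. inj_on x {1..L} \<and> x ` {1..L} \<subseteq> S \<and> strictly_monotonic_dir x L d)"

definition contains_monotonic :: "(real ^ 'n) set \<Rightarrow> nat \<Rightarrow> bool" where
  "contains_monotonic S L \<longleftrightarrow>
     (\<exists>x. inj_on x {1..L} \<and> x ` {1..L} \<subseteq> S \<and> strictly_monotonic x L)"

(* Ensures that the products defining m_I below are genuine finite products. *)

lemma finite_sign_vectors: "finite (sign_vectors :: (int ^ 'n::finite) set)"
proof -
  have "finite (vec_nth ` (sign_vectors :: (int ^ 'n) set))"
  proof (rule finite_subset)
    show "vec_nth ` (sign_vectors :: (int ^ 'n) set) \<subseteq> Pi\<^sub>E UNIV (\<lambda>_. {-1, 0, 1})"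
      by (auto simp: sign_vectors_def)
    show "finite (Pi\<^sub>E (UNIV :: 'n set) (\<lambda>_. {-1, 0, 1 :: int}))"
      by (intro finite_PiE) auto
  qed
  thus ?thesis
    by (rule finite_imageD) (auto intro: inj_onI simp: vec_eq_iff)
qed

lemma finite_D_n: "finite D_n"
  by (rule finite_subset[OF _ finite_sign_vectors]) (auto simp: D_n_def)

definition m_I :: "(int ^ 'n::{finite,linorder} \<Rightarrow> nat) \<Rightarrow> 'n set \<Rightarrow> nat" where
  "m_I l I = (\<Prod>d\<in>{d \<in> D_n. supp d = I}. l d)"

function lambda_I :: "(int ^ 'n::{finite,linorder} \<Rightarrow> nat) \<Rightarrow> 'n set \<Rightarrow> nat" where
  "lambda_I l {} = 1"
| "I \<noteq> {} \<Longrightarrow> lambda_I l I = m_I l I * Max ((\<lambda>i. lambda_I l (I - {i})) ` I)"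
  by auto
termination
  by (relation "Wellfounded.measure (\<lambda>(l, I). card I)")
     (auto simp del: card_Diff_insert card_Diff_singleton intro!: psubset_card_mono)

(* |S| > k, where an infinite S counts as larger than every k (card is 0 on infinite sets). *)

definition size_gt :: "'a set \<Rightarrow> nat \<Rightarrow> bool" where
  "size_gt S k \<longleftrightarrow> infinite S \<or> card S > k"

end

theory Submission
  imports Defs
begin

text \<open>
  For two distinct points \<open>x\<close>, \<open>y\<close> the vector of signs of \<open>y - x\<close>, up to a swap of the two points,
  lies in \<open>D_n\<close>. For each \<open>d\<close> in \<open>D_n\<close> the pairs \<open>(x, y)\<close> for which \<open>y - x\<close> has sign vector \<open>d\<close>
  form a strict partial order. As in Mirsky's theorem, the length \<open>h d x\<close> of a longest chain in direction \<open>d\<close> ending in \<open>x\<close> is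
  strictly increasing along this order; if no chain has more than \<open>l d\<close> elements then \<open>h d\<close>
  takes at most \<open>l d\<close> values. So every pair of distinct points is separated by \<open>h d\<close>, where \<open>d\<close>
  is the direction of that pair. Counting the tuples of all heights only bounds \<open>|S|\<close> by the
  product of all \<open>l d\<close>.

  The sharper bound comes from an induction on the set \<open>I\<close> of coordinates that vary on \<open>S\<close>
  (lemma \<open>card_le_lambda_I\<close>). Colour each point by its heights for the directions with support
  exactly \<open>I\<close>, which uses at most \<open>m\<^sub>I\<close> colours. Two points of one colour cannot differ in all
  coordinates of \<open>I\<close>, so a colour class \<open>T\<close> consists of pairwise agreeing points. If \<open>T\<close> lies
  in a slice \<open>z\<^sub>i = a\<close> then the induction hypothesis for \<open>I - {i}\<close> applies. Otherwise
  \<open>T\<close> is covered by \<open>(|I| - 1)\<^sup>2\<close> double slices \<open>z\<^sub>i = a, z\<^sub>j = b\<close>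
  (lemma \<open>card_pairwise_agreeing_le\<close>), each of size at most \<open>\<lambda>\<close> at \<open>I - {i, j}\<close>. There are
  \<open>2 ^ (k - 1)\<close> directions in \<open>D_n\<close> whose support is a given set of \<open>k > 0\<close> coordinates, so
  \<open>l d \<ge> 2\<close> gives \<open>m \<ge> 2 ^ 2 ^ (|I| - 2)\<close> at \<open>I - {i}\<close>. This is at least \<open>(|I| - 1)\<^sup>2\<close>, with
  equality when \<open>|I| = 3\<close>, so the loss in the cover is absorbed by one step of the recursion
  for \<open>\<lambda>\<close>.

  For constant \<open>l = k\<close> the recursion gives \<open>k ^ (2 ^ n - 1)\<close>, and the case \<open>k = 1\<close>
  only asks for two distinct points.
\<close>

section \<open>Directions of pairs and heights of points\<close>

definition direction :: "real ^ 'n \<Rightarrow> real ^ 'n \<Rightarrow> int ^ 'n" where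
  "direction x y = (\<chi> i. if x $ i < y $ i then 1 else if x $ i = y $ i then 0 else -1)"

lemma direction_in_sign_vectors: "direction x y \<in> sign_vectors"
  by (auto simp: direction_def sign_vectors_def)

lemma supp_direction: "supp (direction x y) = {i. x $ i \<noteq> y $ i}"
  by (auto simp: direction_def supp_def)

lemma direction_eq_0_iff: "direction x y = 0 \<longleftrightarrow> x = y"
  by (auto simp: direction_def vec_eq_iff)

lemma direction_swap: "direction y x = - direction x y"
  by (auto simp: direction_def vec_eq_iff)

lemma direction_trans:
  assumes "direction x y = d" "direction y z = d"
  shows "direction x z = d"
proof -
  have "direction x z $ i = direction x y $ i" for i
  proof -
    have "direction x y $ i = direction y z $ i" using assms by simp
    thus ?thesis by (simp add: direction_def split: if_splits)
  qed
  thus ?thesis using assms(1) by (simp add: vec_eq_iff)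
qed

lemma direction_in_D_n:
  fixes x y :: "real ^ 'n::{finite,linorder}"
  assumes "x \<noteq> y"
  shows "direction x y \<in> D_n \<or> direction y x \<in> D_n"
proof -
  let ?d = "direction x y"
  have "?d \<noteq> 0" using assms by (simp add: direction_eq_0_iff)
  hence "supp ?d \<noteq> {}" by (auto simp: supp_def vec_eq_iff)
  hence "Min (supp ?d) \<in> supp ?d" by simp
  hence "?d $ Min (supp ?d) = 1 \<or> (- ?d) $ Min (supp ?d) = 1"
    using direction_in_sign_vectors[of x y] by (auto simp: supp_def sign_vectors_def)
  moreover have "supp (- ?d) = supp ?d" by (simp add: supp_def)
  moreover have "- ?d \<in> sign_vectors"
    using direction_in_sign_vectors[of x y] by (auto simp: sign_vectors_def)
  ultimately show ?thesis
    using \<open>?d \<noteq> 0\<close> direction_in_sign_vectors[of x y] by (auto simp: D_n_def direction_swap[of y x])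
qed

text \<open>
  Strict monotonicity becomes a condition on pairs of points, so chains can be shortened and
  prolonged without looking at single coordinates.
\<close>

lemma strictly_monotonic_dir_iff:
  assumes "d \<in> sign_vectors"
  shows "strictly_monotonic_dir z L d \<longleftrightarrow>
    (\<forall>j k. 1 \<le> j \<longrightarrow> j < k \<longrightarrow> k \<le> L \<longrightarrow> direction (z j) (z k) = d)"
    (is "?M \<longleftrightarrow> ?P")
proof
  assume M: ?M
  show ?P
  proof (intro allI impI)
    fix j k :: nat assume jk: "1 \<le> j" "j < k" "k \<le> L"
    have "direction (z j) (z k) $ i = d $ i" for i
    proof -
      consider "d $ i = -1" | "d $ i = 0" | "d $ i = 1"
        using assms by (auto simp: sign_vectors_def)
      thus ?thesis
      proof cases
        case 1
        hence "strict_antimono_on {1..L} (\<lambda>j. z j $ i)" using M by (simp add: strictly_monotonic_dir_def)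
        hence "z k $ i < z j $ i" using jk by (auto simp: monotone_on_def)
        thus ?thesis using 1 by (simp add: direction_def)
      next
        case 2
        hence "(\<lambda>j. z j $ i) constant_on {1..L}" using M by (simp add: strictly_monotonic_dir_def)
        hence "z k $ i = z j $ i" using jk by (auto simp: constant_on_def)
        thus ?thesis using 2 by (simp add: direction_def)
      next
        case 3
        hence "strict_mono_on {1..L} (\<lambda>j. z j $ i)" using M by (simp add: strictly_monotonic_dir_def)
        hence "z j $ i < z k $ i" using jk by (auto simp: monotone_on_def)
        thus ?thesis using 3 by (simp add: direction_def)
      qed
    qed
    thus "direction (z j) (z k) = d" by (simp add: vec_eq_iff)
  qed
next
  assume P: ?P
  have dir: "d $ i = (if z j $ i < z k $ i then 1 else if z j $ i = z k $ i then 0 else -1)"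
    if "1 \<le> j" "j < k" "k \<le> L" for i j k
  proof -
    have "d = direction (z j) (z k)" using P that by metis
    thus ?thesis by (simp add: direction_def)
  qed
  show ?M
    unfolding strictly_monotonic_dir_def
  proof (intro allI conjI impI)
    fix i assume di: "d $ i = -1"
    show "strict_antimono_on {1..L} (\<lambda>j. z j $ i)"
    proof (rule monotone_onI)
      fix j k assume "j \<in> {1..L}" "k \<in> {1..L}" "j < k"
      thus "z k $ i < z j $ i" using dir[of j k i] di by (simp split: if_splits)
    qed
  next
    fix i assume di: "d $ i = 0"
    have "z j $ i = z 1 $ i" if "j \<in> {1..L}" for j
      using that di dir[of 1 j i] by (cases "j = 1") (simp_all split: if_splits)
    thus "(\<lambda>j. z j $ i) constant_on {1..L}" unfolding constant_on_def by blast
  next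
    fix i assume di: "d $ i = 1"
    show "strict_mono_on {1..L} (\<lambda>j. z j $ i)"
    proof (rule monotone_onI)
      fix j k assume "j \<in> {1..L}" "k \<in> {1..L}" "j < k"
      thus "z j $ i < z k $ i" using dir[of j k i] di by (simp split: if_splits)
    qed
  qed
qed

lemma contains_monotonic_dirI:
  assumes "d \<in> sign_vectors" "d \<noteq> 0" "z ` {1..L} \<subseteq> S" "strictly_monotonic_dir z L d"
  shows "contains_monotonic_dir S L d"
proof -
  have dir: "direction (z j) (z k) = d" if "1 \<le> j" "j < k" "k \<le> L" for j k
    using assms(1,4) that by (simp add: strictly_monotonic_dir_iff)
  have "inj_on z {1..L}"
  proof (rule linorder_inj_onI')
    fix j k assume "j \<in> {1..L}" "k \<in> {1..L}" "j < k"
    hence "direction (z j) (z k) \<noteq> 0" using dir assms(2) by simp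
    thus "z j \<noteq> z k" by (simp add: direction_eq_0_iff)
  qed
  thus ?thesis using assms by (auto simp: contains_monotonic_dir_def)
qed

definition chain_lengths ::
  "(real ^ 'n) set \<Rightarrow> int ^ 'n \<Rightarrow> real ^ 'n \<Rightarrow> nat set" where
  "chain_lengths S d x =
     {L. 1 \<le> L \<and> (\<exists>z. z ` {1..L} \<subseteq> S \<and> strictly_monotonic_dir z L d \<and> z L = x)}"

definition height :: "(real ^ 'n) set \<Rightarrow> int ^ 'n \<Rightarrow> real ^ 'n \<Rightarrow> nat" where
  "height S d x = Max (chain_lengths S d x)"

text \<open>An initial segment of a chain is again a chain, so a long chain would contain one of length
  exactly \<open>b + 1\<close>.\<close>

lemma chain_lengths_bounded:
  assumes "d \<in> sign_vectors" "d \<noteq> 0" "\<not> contains_monotonic_dir S (b + 1) d"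
  shows "chain_lengths S d x \<subseteq> {1..b}"
proof
  fix L assume "L \<in> chain_lengths S d x"
  then obtain z where z: "1 \<le> L" "z ` {1..L} \<subseteq> S" "strictly_monotonic_dir z L d"
    by (auto simp: chain_lengths_def)
  have "L \<le> b"
  proof (rule ccontr)
    assume L: "\<not> L \<le> b"
    have "contains_monotonic_dir S (b + 1) d"
    proof (rule contains_monotonic_dirI[OF assms(1,2)])
      show "z ` {1..b + 1} \<subseteq> S" using z(2) L by fastforce
      show "strictly_monotonic_dir z (b + 1) d"
        using z(3) L assms(1) by (auto simp: strictly_monotonic_dir_iff)
    qed
    thus False using assms(3) by simp
  qed
  thus "L \<in> {1..b}" using z(1) by simp
qed

lemma height_in_range:
  assumes "d \<in> sign_vectors" "d \<noteq> 0" "\<not> contains_monotonic_dir S (b + 1) d" "x \<in> S"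
  shows "height S d x \<in> chain_lengths S d x" "height S d x \<in> {1..b}"
proof -
  have "strictly_monotonic_dir (\<lambda>_. x) 1 d"
    using assms(1) by (simp add: strictly_monotonic_dir_iff)
  hence "1 \<in> chain_lengths S d x" using assms(4) by (auto simp: chain_lengths_def)
  moreover note sub = chain_lengths_bounded[OF assms(1-3), of x]
  ultimately show "height S d x \<in> chain_lengths S d x"
    unfolding height_def by (intro Max_in) (auto dest: finite_subset)
  thus "height S d x \<in> {1..b}" using sub by blast
qed

text \<open>A longest chain ending in \<open>x\<close> can be prolonged by \<open>y\<close>, by transitivity. This makes the
  heights separate every pair of points.\<close>

lemma height_less:
  assumes "\<not> contains_monotonic_dir S (b + 1) (direction x y)" "x \<in> S" "y \<in> S" "x \<noteq> y"
  shows "height S (direction x y) x < height S (direction x y) y"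
proof -
  define d where "d = direction x y"
  have d: "d \<in> sign_vectors" "d \<noteq> 0" "\<not> contains_monotonic_dir S (b + 1) d"
    using assms by (simp_all add: d_def direction_in_sign_vectors direction_eq_0_iff)
  define L where "L = height S d x"
  have "L \<in> chain_lengths S d x" using height_in_range(1)[OF d assms(2)] by (simp add: L_def)
  then obtain z where z: "1 \<le> L" "z ` {1..L} \<subseteq> S" "strictly_monotonic_dir z L d" "z L = x"
    by (auto simp: chain_lengths_def)
  define z' where "z' = z(Suc L := y)"
  have old: "direction (z j) (z k) = d" if "1 \<le> j" "j < k" "k \<le> L" for j k
    using z(3) that by (simp add: strictly_monotonic_dir_iff[OF d(1)])
  have "strictly_monotonic_dir z' (Suc L) d"
    unfolding strictly_monotonic_dir_iff[OF d(1)]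
  proof (intro allI impI)
    fix j k :: nat assume jk: "1 \<le> j" "j < k" "k \<le> Suc L"
    show "direction (z' j) (z' k) = d"
    proof (cases "k = Suc L")
      case True
      have "direction (z j) y = d"
      proof (cases "j = L")
        case True thus ?thesis using z(4) by (simp add: d_def)
      next
        case False
        hence "direction (z j) x = d" using old[of j L] jk True z(4) by simp
        thus ?thesis by (rule direction_trans) (simp add: d_def)
      qed
      thus ?thesis using jk True by (simp add: z'_def)
    next
      case False
      thus ?thesis using old[of j k] jk by (simp add: z'_def)
    qed
  qed
  moreover have "z' (Suc L) = y" by (simp add: z'_def)
  moreover have "z' ` {1..Suc L} \<subseteq> S"
  proof (rule image_subsetI)
    fix j assume "j \<in> {1..Suc L}"
    thus "z' j \<in> S" using z(2) assms(3) by (cases "j = Suc L") (auto simp: z'_def)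
  qed
  ultimately have "Suc L \<in> chain_lengths S d y"
    unfolding chain_lengths_def mem_Collect_eq by (intro conjI exI[of _ z']) simp_all
  moreover have "finite (chain_lengths S d y)"
    using chain_lengths_bounded[OF d] finite_subset by blast
  ultimately have "Suc L \<le> height S d y" unfolding height_def by (rule Max_ge[rotated])
  thus ?thesis by (simp add: L_def d_def)
qed

section \<open>The numbers \<open>\<lambda>\<^sub>I\<close>\<close>

text \<open>
  A vector of \<open>D_n\<close> with support \<open>I\<close> has entry 1 at the least element of \<open>I\<close> and free signs
  elsewhere on \<open>I\<close>, so it is determined by the set of its negative entries.
\<close>

lemma card_D_n_supp:
  fixes I :: "'n::{finite,linorder} set"
  assumes "I \<noteq> {}"
  shows "card {d \<in> D_n. supp d = I} = 2 ^ (card I - 1)"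
proof -
  let ?neg = "\<lambda>d :: int ^ 'n::{finite,linorder}. {i. d $ i = -1}"
  let ?vec = "\<lambda>A :: 'n::{finite,linorder} set. (\<chi> i. if i \<in> A then -1 else if i \<in> I then 1 else (0 :: int))"
  have Min: "Min I \<in> I" using assms by simp
  have "bij_betw ?neg {d \<in> D_n. supp d = I} (Pow (I - {Min I}))"
  proof (rule bij_betw_byWitness[where f' = ?vec])
    show "\<forall>d\<in>{d \<in> D_n. supp d = I}. ?vec (?neg d) = d"
      by (force simp: D_n_def sign_vectors_def supp_def vec_eq_iff)
    show "\<forall>A\<in>Pow (I - {Min I}). ?neg (?vec A) = A"
      by auto
    show "?neg ` {d \<in> D_n. supp d = I} \<subseteq> Pow (I - {Min I})"
      by (auto simp: D_n_def supp_def)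
    have "?vec A \<in> {d \<in> D_n. supp d = I}" if "A \<subseteq> I - {Min I}" for A
    proof -
      have "supp (?vec A) = I" using that by (auto simp: supp_def)
      moreover have "?vec A $ Min I = 1" using that Min by auto
      moreover from this have "?vec A \<noteq> 0" by (metis zero_index zero_neq_one)
      moreover have "?vec A \<in> sign_vectors" by (simp add: sign_vectors_def)
      ultimately show ?thesis unfolding D_n_def by simp
    qed
    thus "?vec ` Pow (I - {Min I}) \<subseteq> {d \<in> D_n. supp d = I}" by blast
  qed
  hence "card {d \<in> D_n. supp d = I} = card (Pow (I - {Min I}))" by (rule bij_betw_same_card)
  thus ?thesis using Min by (simp add: card_Pow)
qed

lemma m_I_ge:
  assumes "\<forall>d\<in>D_n. 2 \<le> l d" "I \<noteq> {}"
  shows "2 ^ (2 ^ (card I - 1)) \<le> m_I l I"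
proof -
  have "(\<Prod>d\<in>{d \<in> D_n. supp d = I}. 2) \<le> m_I l I"
    unfolding m_I_def by (rule prod_mono) (use assms(1) in auto)
  thus ?thesis using card_D_n_supp[OF assms(2)] by simp
qed

lemma lambda_I_const: "lambda_I (\<lambda>_. k) I = k ^ (2 ^ card I - 1)"
proof (induction I rule: measure_induct_rule[of card])
  case (less I)
  show ?case
  proof (cases "I = {}")
    case False
    hence pos: "card I > 0" by (simp add: card_gt_0_iff)
    have "lambda_I (\<lambda>_. k) (I - {i}) = k ^ (2 ^ (card I - 1) - 1)" if "i \<in> I" for i
      using less[of "I - {i}"] that pos by simp
    hence "(\<lambda>i. lambda_I (\<lambda>_. k) (I - {i})) ` I = {k ^ (2 ^ (card I - 1) - 1)}"
      using False by (auto simp: image_def)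
    hence "lambda_I (\<lambda>_. k) I = k ^ (2 ^ (card I - 1)) * k ^ (2 ^ (card I - 1) - 1)"
      using False card_D_n_supp[OF False] by (simp add: m_I_def)
    also have "\<dots> = k ^ (2 ^ (card I - 1) + (2 ^ (card I - 1) - 1))"
      by (simp only: power_add)
    also have "2 ^ (card I - 1) + (2 ^ (card I - 1) - 1) = 2 ^ card I - (1::nat)"
      using pos by (cases "card I") auto
    finally show ?thesis .
  qed simp
qed

text \<open>With \<open>k = |I| - 1\<close> this compares the number of double slices in the cover of a colour class
  with the lower bound for \<open>m\<close> at sets of size \<open>k\<close>; it is sharp at \<open>k = 2\<close>.\<close>

lemma square_le_double_exp:
  assumes "1 \<le> k"
  shows "k ^ 2 \<le> (2::nat) ^ (2 ^ (k - 1))"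
proof (cases "k = 1")
  case False
  then obtain j where k: "k = Suc (Suc j)" using assms
    by (metis One_nat_def Suc_le_D not0_implies_Suc)
  have "k \<le> 2 ^ Suc j" using less_exp[of "Suc j"] by (simp add: k)
  also have "\<dots> \<le> 2 ^ (2 ^ j)" by (intro power_increasing) (use less_exp[of j] in \<open>simp_all add: Suc_leI\<close>)
  finally have "k ^ 2 \<le> (2 ^ (2 ^ j)) ^ 2" by (rule power_mono) simp
  thus ?thesis by (simp add: k power_mult[symmetric] mult.commute)
qed simp

section \<open>Pairwise agreeing sets of points\<close>

text \<open>
  Fix points \<open>x\<close>, \<open>y\<close> of \<open>T\<close> and a coordinate \<open>i\<close> with \<open>x\<^sub>i = y\<^sub>i\<close>, and let \<open>n = |I|\<close>. A point on the
  slice through \<open>x\<close> at \<open>i\<close> must agree with some fixed point \<open>w\<close> off this slice at a second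
  coordinate, which gives \<open>n - 1\<close> double slices. A point off this slice should agree with \<open>x\<close> at
  some \<open>j\<close> and with \<open>y\<close> at some other \<open>k\<close>, which gives \<open>(n - 1) * (n - 2)\<close> more,
  hence \<open>(n - 1)\<^sup>2\<close> in total. If some pair agrees at \<open>i\<close> only, take it as \<open>x\<close>, \<open>y\<close>; if every
  pair agrees at two or more coordinates, take \<open>y = x\<close>. The more direct cover by the slices of
  one point \<open>x\<close>, each cut by a point off it, has \<open>n * (n - 1)\<close> members, which is too many for
  the application at \<open>n = 3\<close>.
\<close>

lemma card_pairwise_agreeing_le:
  fixes T :: "('a ^ 'n::finite) set"
  assumes fin: "finite T"
    and agree: "\<And>x y. x \<in> T \<Longrightarrow> y \<in> T \<Longrightarrow> \<exists>i\<in>I. x $ i = y $ i"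
    and not_in_slice: "\<And>i c. i \<in> I \<Longrightarrow> \<exists>z\<in>T. z $ i \<noteq> c"
    and double_slice: "\<And>i j a b. i \<in> I \<Longrightarrow> j \<in> I \<Longrightarrow> i \<noteq> j \<Longrightarrow>
      card {z \<in> T. z $ i = a \<and> z $ j = b} \<le> B"
  shows "card T \<le> (card I - 1) ^ 2 * B"
proof (cases "T = {}")
  case False
  have "\<exists>x\<in>T. \<exists>y\<in>T. \<exists>i\<in>I. \<forall>z\<in>T. z $ i \<noteq> x $ i \<longrightarrow>
    (\<exists>j\<in>I - {i}. \<exists>k\<in>I - {i} - {j}. z $ j = x $ j \<and> z $ k = y $ k)"
  proof (cases "\<exists>x\<in>T. \<exists>y\<in>T. \<exists>i\<in>I. \<forall>j\<in>I. x $ j = y $ j \<longleftrightarrow> j = i")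
    case True
    then obtain x y i where xyi: "x \<in> T" "y \<in> T" "i \<in> I" "\<And>j. j \<in> I \<Longrightarrow> x $ j = y $ j \<longleftrightarrow> j = i"
      by blast
    have "\<exists>j\<in>I - {i}. \<exists>k\<in>I - {i} - {j}. z $ j = x $ j \<and> z $ k = y $ k"
      if z: "z \<in> T" "z $ i \<noteq> x $ i" for z
    proof -
      obtain j where j: "j \<in> I" "z $ j = x $ j" using agree[OF z(1) xyi(1)] by blast
      obtain k where k: "k \<in> I" "z $ k = y $ k" using agree[OF z(1) xyi(2)] by blast
      have "j \<noteq> i" "k \<noteq> i" using j k z(2) xyi(4)[OF xyi(3)] by auto
      \<comment> \<open>otherwise \<open>x\<close> and \<open>y\<close> would agree at \<open>j\<close>, away from \<open>i\<close>\<close>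
      moreover have "j \<noteq> k" using j k xyi(4)[of j] \<open>j \<noteq> i\<close> by auto
      ultimately show ?thesis using j k by blast
    qed
    thus ?thesis using xyi(1-3) by blast
  next
    case no_single: False
    obtain x where x: "x \<in> T" using False by blast
    obtain i where i: "i \<in> I" using agree[OF x x] by blast
    have "\<exists>j\<in>I - {i}. \<exists>k\<in>I - {i} - {j}. z $ j = x $ j \<and> z $ k = x $ k"
      if z: "z \<in> T" "z $ i \<noteq> x $ i" for z
    proof -
      obtain j where j: "j \<in> I" "z $ j = x $ j" using agree[OF z(1) x] by blast
      obtain k where "k \<in> I" "z $ k = x $ k" "k \<noteq> j" using no_single z(1) x j by blast
      thus ?thesis using j z(2) by blast
    qed
    thus ?thesis using x i by blast
  qed
  then obtain x y i where i: "i \<in> I" and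
    off: "\<And>z. z \<in> T \<Longrightarrow> z $ i \<noteq> x $ i \<Longrightarrow>
      \<exists>j\<in>I - {i}. \<exists>k\<in>I - {i} - {j}. z $ j = x $ j \<and> z $ k = y $ k"
    by blast
  obtain w where w: "w \<in> T" "w $ i \<noteq> x $ i" using not_in_slice[OF i] by blast
  let ?J = "I - {i}"
  let ?on = "\<lambda>j. {z \<in> T. z $ i = x $ i \<and> z $ j = w $ j}"
  let ?off = "\<lambda>j k. {z \<in> T. z $ j = x $ j \<and> z $ k = y $ k}"
  have "T \<subseteq> (\<Union>j\<in>?J. ?on j) \<union> (\<Union>j\<in>?J. \<Union>k\<in>?J - {j}. ?off j k)"
  proof
    fix z assume z: "z \<in> T"
    show "z \<in> (\<Union>j\<in>?J. ?on j) \<union> (\<Union>j\<in>?J. \<Union>k\<in>?J - {j}. ?off j k)"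
    proof (cases "z $ i = x $ i")
      case True
      obtain j where "j \<in> I" "z $ j = w $ j" using agree[OF z w(1)] by blast
      thus ?thesis using True z w(2) by fastforce
    next
      case False
      thus ?thesis using off[OF z False] z by blast
    qed
  qed
  hence "card T \<le> card ((\<Union>j\<in>?J. ?on j) \<union> (\<Union>j\<in>?J. \<Union>k\<in>?J - {j}. ?off j k))"
    by (rule card_mono[rotated]) (use fin in auto)
  also have "\<dots> \<le> card (\<Union>j\<in>?J. ?on j) + card (\<Union>j\<in>?J. \<Union>k\<in>?J - {j}. ?off j k)"
    by (rule card_Un_le)
  also have "\<dots> \<le> card ?J * B + card ?J * ((card ?J - 1) * B)"
  proof (rule add_mono)
    have "card (\<Union>j\<in>?J. ?on j) \<le> (\<Sum>j\<in>?J. card (?on j))" by (rule card_UN_le) simp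
    also have "\<dots> \<le> card ?J * B"
      using sum_bounded_above[of ?J "\<lambda>j. card (?on j)" B] double_slice[OF i] by force
    finally show "card (\<Union>j\<in>?J. ?on j) \<le> card ?J * B" .
    have inner: "card (\<Union>k\<in>?J - {j}. ?off j k) \<le> (card ?J - 1) * B" if j: "j \<in> ?J" for j
    proof -
      have "card (\<Union>k\<in>?J - {j}. ?off j k) \<le> (\<Sum>k\<in>?J - {j}. card (?off j k))"
        by (rule card_UN_le) simp
      also have "\<dots> \<le> (\<Sum>k\<in>?J - {j}. B)"
        by (rule sum_mono) (use j in \<open>auto intro!: double_slice\<close>)
      also have "\<dots> = (card ?J - 1) * B" using j by simp
      finally show ?thesis .
    qed
    have "card (\<Union>j\<in>?J. \<Union>k\<in>?J - {j}. ?off j k) \<le> (\<Sum>j\<in>?J. card (\<Union>k\<in>?J - {j}. ?off j k))"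
      by (rule card_UN_le) simp
    also have "\<dots> \<le> (\<Sum>j\<in>?J. (card ?J - 1) * B)" by (rule sum_mono) (rule inner)
    finally show "card (\<Union>j\<in>?J. \<Union>k\<in>?J - {j}. ?off j k) \<le> card ?J * ((card ?J - 1) * B)"
      by simp
  qed
  also have "\<dots> = card ?J ^ 2 * B"
    by (cases "card ?J") (simp_all add: power2_eq_square algebra_simps)
  finally show ?thesis using i by simp
qed simp

section \<open>The size bound\<close>

lemma card_le_by_fibres:
  assumes "finite A" "finite C" "f ` A \<subseteq> C" "\<And>c. c \<in> C \<Longrightarrow> card {x \<in> A. f x = c} \<le> B"
  shows "card A \<le> card C * B"
proof -
  have "A = (\<Union>c\<in>C. {x \<in> A. f x = c})" using assms(3) by auto
  hence "card A \<le> (\<Sum>c\<in>C. card {x \<in> A. f x = c})" using card_UN_le[OF assms(2)] by metis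
  also have "\<dots> \<le> card C * B" using sum_bounded_above[of C _ B] assms(4) by force
  finally show ?thesis .
qed

text \<open>
  The heights enter only as labellings \<open>h d\<close> with \<open>l d\<close> values that separate the pairs with
  direction \<open>d\<close>. Such labellings restrict to subsets, so the heights are computed once and not
  again for each colour class and slice. The last hypothesis replaces a projection to \<open>\<real>\<^sup>I\<close>, so that
  all induction steps take place in one space.
\<close>

lemma card_le_lambda_I:
  fixes l :: "int ^ 'n::{finite,linorder} \<Rightarrow> nat"
    and h :: "int ^ 'n::{finite,linorder} \<Rightarrow> real ^ 'n::{finite,linorder} \<Rightarrow> nat"
  assumes l: "\<forall>d\<in>D_n. 2 \<le> l d"
    and "finite S"
    and range: "\<And>d x. d \<in> D_n \<Longrightarrow> x \<in> S \<Longrightarrow> h d x \<in> {1..l d}"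
    and sep: "\<And>x y. x \<in> S \<Longrightarrow> y \<in> S \<Longrightarrow> direction x y \<in> D_n \<Longrightarrow>
      h (direction x y) x \<noteq> h (direction x y) y"
    and "\<And>x y i. x \<in> S \<Longrightarrow> y \<in> S \<Longrightarrow> i \<notin> I \<Longrightarrow> x $ i = y $ i"
  shows "card S \<le> lambda_I l I"
  using assms(2-)
proof (induction I arbitrary: S rule: measure_induct_rule[of card])
  case (less I)
  note fin = less.prems(1) and range = less.prems(2) and sep = less.prems(3)
    and const = less.prems(4)
  show ?case
  proof (cases "I = {}")
    case True
    hence "x = y" if "x \<in> S" "y \<in> S" for x y using const[OF that] True by (metis empty_iff vec_eq_iff)
    hence "card S \<le> Suc 0" using fin by (subst card_le_Suc0_iff_eq) auto
    thus ?thesis using True by simp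
  next
    case False
    define M where "M = Max ((\<lambda>i. lambda_I l (I - {i})) ` I)"
    have M: "lambda_I l (I - {i}) \<le> M" if "i \<in> I" for i
      unfolding M_def using that by (intro Max_ge) auto
    let ?D = "{d \<in> D_n. supp d = I}"
    let ?colour = "\<lambda>x. restrict (\<lambda>d. h d x) ?D"
    let ?C = "Pi\<^sub>E ?D (\<lambda>d. {1..l d})"
    have finD: "finite ?D" by (rule finite_subset[OF _ finite_D_n]) blast
    have IH: "card T \<le> lambda_I l J"
      if "T \<subseteq> S" "J \<subset> I" "\<And>x y i. x \<in> T \<Longrightarrow> y \<in> T \<Longrightarrow> i \<notin> J \<Longrightarrow> x $ i = y $ i" for T J
    proof (rule less.IH)
      show "card J < card I" using that(2) by (simp add: psubset_card_mono)
      show "finite T" using that(1) fin by (rule finite_subset)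
      show "h d x \<in> {1..l d}" if "d \<in> D_n" "x \<in> T" for d x
        using range that \<open>T \<subseteq> S\<close> by blast
      show "h (direction x y) x \<noteq> h (direction x y) y"
        if "x \<in> T" "y \<in> T" "direction x y \<in> D_n" for x y
        using sep that \<open>T \<subseteq> S\<close> by blast
    qed (rule that(3))
    have fibre: "card {x \<in> S. ?colour x = c} \<le> M" for c
    proof -
      define T where "T = {x \<in> S. ?colour x = c}"
      have TS: "T \<subseteq> S" by (auto simp: T_def)
      have same: "h d x = h d y" if "x \<in> T" "y \<in> T" "d \<in> ?D" for x y d
      proof -
        have "?colour x d = ?colour y d" using that(1,2) by (simp add: T_def)
        thus ?thesis using that(3) by simp
      qed
      have agree: "\<exists>i\<in>I. x $ i = y $ i" if xy: "x \<in> T" "y \<in> T" for x y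
      proof (rule ccontr)
        assume differ: "\<not> (\<exists>i\<in>I. x $ i = y $ i)"
        have "x $ i \<noteq> y $ i \<longleftrightarrow> i \<in> I" for i
          using differ const xy TS by blast
        hence supp: "supp (direction x y) = I" "supp (direction y x) = I"
          unfolding supp_direction by (blast, metis (mono_tags, lifting) Collect_cong Collect_mem_eq)
        have "x \<noteq> y" using differ False by blast
        then consider "direction x y \<in> D_n" | "direction y x \<in> D_n"
          using direction_in_D_n by blast
        thus False
        proof cases
          case 1
          thus False using sep[of x y] same[OF xy, of "direction x y"] supp xy TS by blast
        next
          case 2
          thus False using sep[of y x] same[OF xy(2,1), of "direction y x"] supp xy TS by blast
        qed
      qed
      show ?thesis
      proof (cases "\<exists>i\<in>I. \<exists>a. \<forall>z\<in>T. z $ i = a")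
        case True
        then obtain i a where i: "i \<in> I" "\<forall>z\<in>T. z $ i = a" by blast
        have "card T \<le> lambda_I l (I - {i})"
        proof (rule IH[OF TS])
          fix x y j assume "x \<in> T" "y \<in> T" "j \<notin> I - {i}"
          thus "x $ j = y $ j" using i const[of x y j] TS by (cases "j = i") auto
        qed (use i in auto)
        thus ?thesis using M[OF i(1)] by (simp add: T_def)
      next
        case not_slice: False
        \<comment> \<open>For \<open>|I| = 1\<close> the quotient below is a division by 0, but then there are no double
            slices and the bound is 0.\<close>
        let ?q = "(card I - 1) ^ 2"
        have "card T \<le> ?q * (M div ?q)"
        proof (rule card_pairwise_agreeing_le)
          show "finite T" using TS fin finite_subset by blast
          show "\<exists>z\<in>T. z $ i \<noteq> a" if "i \<in> I" for i a using not_slice that by blast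
          fix i j a b
          assume ij: "i \<in> I" "j \<in> I" "i \<noteq> j"
          let ?T = "{z \<in> T. z $ i = a \<and> z $ j = b}"
          let ?I = "I - {i}"
          have "card {i, j} \<le> card I" using ij by (intro card_mono) auto
          hence cI: "1 \<le> card I - 1" using ij(3) by simp
          have ne: "?I \<noteq> {}" using ij by auto
          have "card ?T \<le> lambda_I l (?I - {j})"
          proof (rule IH)
            fix x y k assume "x \<in> ?T" "y \<in> ?T" "k \<notin> ?I - {j}"
            thus "x $ k = y $ k"
              using const[of x y k] TS by (cases "k = i"; cases "k = j") auto
          qed (use ij TS in auto)
          hence "?q * card ?T \<le> 2 ^ (2 ^ (card ?I - 1)) * lambda_I l (?I - {j})"
            using square_le_double_exp[OF cI] ij by (intro mult_mono) auto
          also have "\<dots> \<le> m_I l ?I * Max ((\<lambda>j. lambda_I l (?I - {j})) ` ?I)"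
            by (intro mult_mono m_I_ge l ne Max_ge) (use ij in auto)
          also have "\<dots> = lambda_I l ?I" using ne by simp
          also have "\<dots> \<le> M" by (rule M[OF ij(1)])
          finally have "?q * card ?T \<le> M" .
          thus "card ?T \<le> M div ?q"
            using cI by (subst less_eq_div_iff_mult_less_eq) (auto simp: mult.commute)
        qed (rule agree)
        also have "\<dots> \<le> M" by simp
        finally show ?thesis by (simp add: T_def)
      qed
    qed
    have "card S \<le> card ?C * M"
    proof (rule card_le_by_fibres[OF fin _ _ fibre])
      show "finite ?C" using finD by (intro finite_PiE) auto
      show "?colour ` S \<subseteq> ?C" 
      proof (rule image_subsetI)
        fix x assume "x \<in> S"
        thus "?colour x \<in> ?C" using range[of _ x] by (intro restrict_PiE_iff[THEN iffD2]) blast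
      qed
    qed
    also have "card ?C = m_I l I" using finD by (simp add: card_PiE m_I_def)
    finally show ?thesis using False by (simp add: M_def)
  qed
qed

lemma monotonic_dir_of_size_gt_lambda_I:
  fixes S :: "(real ^ 'n::{finite,linorder}) set"
  assumes l: "\<forall>d\<in>D_n. 2 \<le> l d" and big: "size_gt S (lambda_I l UNIV)"
  shows "\<exists>d\<in>D_n. contains_monotonic_dir S (l d + 1) d"
proof (rule ccontr)
  assume none: "\<not> (\<exists>d\<in>D_n. contains_monotonic_dir S (l d + 1) d)"
  \<comment> \<open>An infinite \<open>S\<close> is replaced by a finite subset that is still too large.\<close>
  obtain S' where S': "S' \<subseteq> S" "finite S'" "card S' > lambda_I l UNIV"
  proof (cases "finite S")
    case False
    thus ?thesis using infinite_arbitrarily_large[of S "Suc (lambda_I l UNIV)"] that by force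
  qed (use big that in \<open>auto simp: size_gt_def\<close>)
  have none': "\<not> contains_monotonic_dir S' (l d + 1) d" if "d \<in> D_n" for d
    using none that S'(1) by (fastforce simp: contains_monotonic_dir_def)
  have "card S' \<le> lambda_I l UNIV"
  proof (rule card_le_lambda_I[OF l S'(2), of "height S'"])
    show "height S' d x \<in> {1..l d}" if "d \<in> D_n" "x \<in> S'" for d x
      by (rule height_in_range(2)) (use that none' in \<open>auto simp: D_n_def\<close>)
    show "height S' (direction x y) x \<noteq> height S' (direction x y) y"
      if "x \<in> S'" "y \<in> S'" "direction x y \<in> D_n" for x y
    proof -
      have "x \<noteq> y" using that(3) by (auto simp: D_n_def direction_eq_0_iff[symmetric])
      from height_less[OF none'[OF that(3)] that(1,2) this] show ?thesis by simp
    qed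
  qed simp
  thus False using S'(3) by linarith
qed

lemma contains_monotonic_of_dir:
  assumes "contains_monotonic_dir S L d" "d \<in> sign_vectors"
  shows "contains_monotonic S L"
  using assms unfolding contains_monotonic_dir_def contains_monotonic_def strictly_monotonic_def
  by blast

lemma contains_monotonic_two:
  assumes "size_gt S 1"
  shows "contains_monotonic S 2"
proof -
  have "\<exists>x\<in>S. \<exists>y\<in>S. x \<noteq> y"
  proof (rule ccontr)
    assume "\<not> (\<exists>x\<in>S. \<exists>y\<in>S. x \<noteq> y)"
    hence "S \<subseteq> {z}" if "z \<in> S" for z using that by blast
    hence "\<exists>z. S \<subseteq> {z}" by blast
    hence "finite S \<and> card S \<le> 1"
      by (metis card_mono finite.emptyI finite.insertI finite_subset is_singletonI is_singleton_altdef)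
    thus False using assms by (auto simp: size_gt_def)
  qed
  then obtain x y where xy: "x \<in> S" "y \<in> S" "x \<noteq> y" by blast
  let ?z = "\<lambda>j::nat. if j = 1 then x else y"
  let ?d = "direction x y"
  have "contains_monotonic_dir S 2 ?d"
  proof (rule contains_monotonic_dirI[of _ ?z])
    show "strictly_monotonic_dir ?z 2 ?d"
      by (auto simp: strictly_monotonic_dir_iff direction_in_sign_vectors)
  qed (use xy in \<open>auto simp: direction_in_sign_vectors direction_eq_0_iff\<close>)
  thus ?thesis by (rule contains_monotonic_of_dir) (rule direction_in_sign_vectors)
qed

theorem theorem6:
  fixes S :: "(real ^ 'n::{finite,linorder}) set"
  shows "(\<forall>l :: int ^ 'n::{finite,linorder} \<Rightarrow> nat. (\<forall>d\<in>D_n. l d \<ge> 2) \<longrightarrow> size_gt S (lambda_I l UNIV) \<longrightarrow>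
            (\<exists>d\<in>D_n. contains_monotonic_dir S (l d + 1) d)) \<and>
         (\<forall>k :: nat. k > 0 \<longrightarrow> size_gt S (k ^ (2 ^ CARD('n::{finite,linorder}) - 1)) \<longrightarrow>
            contains_monotonic S (k + 1))"
proof (intro conjI allI impI)
  fix l :: "int ^ 'n::{finite,linorder} \<Rightarrow> nat"
  assume "\<forall>d\<in>D_n. l d \<ge> 2" "size_gt S (lambda_I l UNIV)"
  thus "\<exists>d\<in>D_n. contains_monotonic_dir S (l d + 1) d"
    by (rule monotonic_dir_of_size_gt_lambda_I)
next
  fix k :: nat
  assume k: "k > 0" and big: "size_gt S (k ^ (2 ^ CARD('n::{finite,linorder}) - 1))"
  show "contains_monotonic S (k + 1)"
  proof (cases "k = 1")
    case True
    thus ?thesis using big contains_monotonic_two[of S] by (simp add: numeral_2_eq_2)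
  next
    case False
    hence "\<exists>d\<in>D_n. contains_monotonic_dir S (k + 1) d"
      using k big monotonic_dir_of_size_gt_lambda_I[of "\<lambda>_. k" S] by (simp add: lambda_I_const)
    thus ?thesis using contains_monotonic_of_dir by (auto simp: D_n_def)
  qed
qed

end
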